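(* Let $D$ be a digraph whose underlying graph is a perfect graph. Then $D$ is a KP-digraph if and only if $D$ has no induced subdigraph $H$ with $H\cong\overrightarrow{C}_3$ or $H\cong \overrightarrow{C}_n(1,\pm2,\pm3,\dots,\pm\lfloor \frac{n}{2}\rfloor)$ for some $n\ge4$. In particular, a semicomplete multipartite digraph or a quasi-transitive digraph is KP if and only if it has no induced subdigraph $H$ with $H\cong \overrightarrow{C}_3$ or $H\cong\overrightarrow{C}_{m}(1,\pm 2,\pm 3,\dots,\pm \lfloor \frac{m}{2} \rfloor )$ for some $m\ge4$.
   Context: Digraphs are finite, without loops or parallel arcs; both arcs $uv$ and $vu$ may be present. The underlying graph $G_D$ has vertex set $V(D)$, with $\{u,v\}$ an edge iff $uv\in A(D)$ or $vu\in A(D)$. A kernel is a set $S$ of vertices that is independent (no arc between two vertices of $S$) and absorbent (every vertex outside $S$ has an arc into $S$). $D$ is a KP-digraph (kernel perfect) if $D$ and every induced subdigraph of $D$ have a kernel. $D$ is semicomplete multipartite if $G_D$ is complete multipartite; $D$ is quasi-transitive if for every directed path $uvw$ there is an arc between $u$ and $w$. For nonempty $J\subseteq\mathbb{Z}_m\setminus\{0\}$, $\overrightarrow{C}_m(J)$ has vertex set $\mathbb{Z}_m$ and arcs $(i,j)$ with $j-i\in J$; here $J=\{1\}\cup\{\pm k:2\le k\le\lfloor m/2\rfloor\}$. $\overrightarrow{C}_3$ is the directed $3$-cycle. *)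

theory Defs
  imports
    "Graph_Theory.Graph_Theory"
    "HOL-Library.Disjoint_Sets"
    "HOL-Number_Theory.Cong"
begin

section \<open>Perfect graphs\<close>

text \<open>Following \<^locale>\<open>graph\<close>, undirected graphs are symmetric loopless digraphs. The functions below
  are meant for such graphs; they refer only to adjacency.\<close>

definition is_clique :: "('a,'b) pre_digraph \<Rightarrow> 'a set \<Rightarrow> bool" where
  "is_clique G K \<longleftrightarrow> K \<subseteq> verts G \<and> (\<forall>u\<in>K. \<forall>v\<in>K. u \<noteq> v \<longrightarrow> u \<rightarrow>\<^bsub>G\<^esub> v)"

definition clique_number :: "('a,'b) pre_digraph \<Rightarrow> nat" where
  "clique_number G = Max (card ` {K. is_clique G K})"

definition colourable :: "('a,'b) pre_digraph \<Rightarrow> nat \<Rightarrow> bool" where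
  "colourable G k \<longleftrightarrow>
    (\<exists>c :: 'a \<Rightarrow> nat. c ` verts G \<subseteq> {..<k} \<and> (\<forall>u v. u \<rightarrow>\<^bsub>G\<^esub> v \<longrightarrow> c u \<noteq> c v))"

definition chromatic_number :: "('a,'b) pre_digraph \<Rightarrow> nat" where
  "chromatic_number G = (LEAST k. colourable G k)"

definition perfect_graph :: "('a,'b) pre_digraph \<Rightarrow> bool" where
  "perfect_graph G \<longleftrightarrow> graph G \<and>
    (\<forall>H. induced_subgraph H G \<longrightarrow> chromatic_number H = clique_number H)"

section \<open>Kernels and classes of digraphs\<close>

abbreviation underlying_graph :: "('a,'b) pre_digraph \<Rightarrow> ('a, 'a \<times> 'a) pre_digraph" where
  "underlying_graph D \<equiv> with_proj (mk_symmetric D)"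

definition is_kernel :: "('a,'b) pre_digraph \<Rightarrow> 'a set \<Rightarrow> bool" where
  "is_kernel D S \<longleftrightarrow> S \<subseteq> verts D \<and>
    (\<forall>u\<in>S. \<forall>v\<in>S. \<not> u \<rightarrow>\<^bsub>D\<^esub> v) \<and>
    (\<forall>u\<in>verts D - S. \<exists>v\<in>S. u \<rightarrow>\<^bsub>D\<^esub> v)"

definition kernel_perfect :: "('a,'b) pre_digraph \<Rightarrow> bool" where
  "kernel_perfect D \<longleftrightarrow> (\<exists>S. is_kernel D S) \<and>
    (\<forall>H. induced_subgraph H D \<longrightarrow> (\<exists>S. is_kernel H S))"

text \<open>The number of parts is arbitrary; a single part (no edges) is allowed.\<close>

definition complete_multipartite :: "('a,'b) pre_digraph \<Rightarrow> bool" where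
  "complete_multipartite G \<longleftrightarrow> graph G \<and>
    (\<exists>P. partition_on (verts G) P \<and>
      arcs_ends G = {(u,v). \<exists>X\<in>P. \<exists>Y\<in>P. X \<noteq> Y \<and> u \<in> X \<and> v \<in> Y})"

definition semicomplete_multipartite :: "('a,'b) pre_digraph \<Rightarrow> bool" where
  "semicomplete_multipartite D \<longleftrightarrow> complete_multipartite (underlying_graph D)"

definition quasi_transitive :: "('a,'b) pre_digraph \<Rightarrow> bool" where
  "quasi_transitive D \<longleftrightarrow>
    (\<forall>u v w. distinct [u, v, w] \<and> u \<rightarrow>\<^bsub>D\<^esub> v \<and> v \<rightarrow>\<^bsub>D\<^esub> w \<longrightarrow> u \<rightarrow>\<^bsub>D\<^esub> w \<or> w \<rightarrow>\<^bsub>D\<^esub> u)"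

section \<open>The forbidden digraphs\<close>

definition directed_triangle :: "int pair_pre_digraph" where
  "directed_triangle = \<lparr> pverts = {0, 1, 2}, parcs = {(0,1), (1,2), (2,0)} \<rparr>"

text \<open>Residue classes modulo \<open>m\<close> are represented by \<open>0, \<dots>, m - 1\<close>; the jumps in \<open>J\<close> are integers
  standing for their residue classes.\<close>

definition circulant :: "nat \<Rightarrow> int set \<Rightarrow> int pair_pre_digraph" where
  "circulant m J = \<lparr> pverts = {0..<int m},
    parcs = {(i,j). i \<in> {0..<int m} \<and> j \<in> {0..<int m} \<and> (\<exists>k\<in>J. [j - i = k] (mod int m))} \<rparr>"

definition jumps :: "nat \<Rightarrow> int set" where
  "jumps m = {1} \<union> (\<Union>k\<in>{2..int (m div 2)}. {k, - k})"

end

theory Submission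
  imports Defs "HOL-Analysis.Brouwer_Fixpoint"
begin

text \<open>In a quasi-transitive digraph a shortest cycle of asymmetric arcs induces a forbidden digraph,
  so without forbidden digraphs the asymmetric arcs form no cycle, and then a kernel exists. This
  settles quasi-transitive digraphs, and in general it shows that the vertices of each clique can be
  listed so that each of them has arcs to all the earlier ones.

  For perfect underlying graphs, write \<open>n\<close> for the number of vertices and \<open>p = n\<^sup>2 + 1\<close>. Kuhn's
  lemma gives integer weights below \<open>p\<close> on every clique such that each vertex \<open>v\<close> ends a clique list
  of weight at least \<open>p - n\<close>; this is an integral version of the fractional kernels of Aharoni and
  Holzman. By Lovasz' replication argument \<open>p\<close> stable sets cover each vertex as often as its weight
  says, and one of them meets all these lists, hence is a kernel.\<close>

section \<open>Asymmetric cycles\<close>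

text \<open>Stated for a relation and a set, so that passing to an induced subdigraph only shrinks
  \<open>U\<close>.\<close>

definition kernel_on :: "('a \<Rightarrow> 'a \<Rightarrow> bool) \<Rightarrow> 'a set \<Rightarrow> 'a set \<Rightarrow> bool" where
  "kernel_on E U S \<longleftrightarrow> S \<subseteq> U \<and> (\<forall>u\<in>S. \<forall>v\<in>S. \<not> E u v) \<and> (\<forall>u\<in>U - S. \<exists>v\<in>S. E u v)"

definition asym_on :: "('a \<Rightarrow> 'a \<Rightarrow> bool) \<Rightarrow> 'a set \<Rightarrow> 'a rel" where
  "asym_on E U = {(u, v). u \<in> U \<and> v \<in> U \<and> E u v \<and> \<not> E v u}"

definition quasi_transitive_on :: "('a \<Rightarrow> 'a \<Rightarrow> bool) \<Rightarrow> 'a set \<Rightarrow> bool" where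
  "quasi_transitive_on E U \<longleftrightarrow>
    (\<forall>u\<in>U. \<forall>v\<in>U. \<forall>w\<in>U. distinct [u, v, w] \<and> E u v \<and> E v w \<longrightarrow> E u w \<or> E w u)"

text \<open>One pattern for all forbidden digraphs: between distinct vertices, only the arcs from
  \<open>f (j + 1)\<close> to \<open>f j\<close> are missing, indices modulo \<open>m\<close>. For
  \<open>m = 3\<close> this is the directed triangle, for larger \<open>m\<close> the
  circulant.\<close>

definition anticycle :: "('a \<Rightarrow> 'a \<Rightarrow> bool) \<Rightarrow> nat \<Rightarrow> (nat \<Rightarrow> 'a) \<Rightarrow> bool" where
  "anticycle E m f \<longleftrightarrow> inj_on f {..<m} \<and>
    (\<forall>i<m. \<forall>j<m. E (f i) (f j) \<longleftrightarrow> i \<noteq> j \<and> i \<noteq> Suc j mod m)"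

text \<open>Any two vertices are adjacent, so a kernel would consist of a single \<open>f i\<close>,
  but the next vertex \<open>f (i + 1)\<close> has no arc to \<open>f i\<close>.\<close>

lemma anticycle_no_kernel:
  assumes "3 \<le> m" "anticycle E m f"
  shows "\<not> kernel_on E (f ` {..<m}) S"
proof
  assume S: "kernel_on E (f ` {..<m}) S"
  have arc: "E (f i) (f j) \<longleftrightarrow> i \<noteq> j \<and> i \<noteq> Suc j mod m" if "i < m" "j < m" for i j
    using assms that by (simp add: anticycle_def)
  \<comment> \<open>By \<open>3 \<le> m\<close>, two steps forward never return to \<open>i\<close>;
    hence no pair lacks both arcs.\<close>
  have succ: "i \<noteq> Suc i mod m" "i \<noteq> Suc (Suc i mod m) mod m" if "i < m" for i
    using that assms(1) by (auto simp: mod_Suc)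
  have adj: "E (f i) (f j) \<or> E (f j) (f i)" if "i < m" "j < m" "i \<noteq> j" for i j
    using arc that succ by metis
  have "f 0 \<in> f ` {..<m}"
    using assms(1) by auto
  then obtain i where i: "i < m" "f i \<in> S"
    using S unfolding kernel_on_def by blast
  define j where "j = Suc i mod m"
  have j: "j < m" "E (f i) (f j)" "\<not> E (f j) (f i)"
    using assms(1) arc i succ by (auto simp: j_def)
  then have "f j \<notin> S"
    using S i by (auto simp: kernel_on_def)
  then obtain l where l: "l < m" "f l \<in> S" "E (f j) (f l)"
    using S j unfolding kernel_on_def by blast
  then have "l \<noteq> i"
    using j by auto
  then show False
    using adj[of l i] l i S unfolding kernel_on_def by blast
qed

lemma relpow_walk:
  assumes R: "\<And>i. (F i, F (Suc i)) \<in> R"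
  shows "(F i, F (i + k)) \<in> R ^^ k"
proof (induction k)
  case (Suc k)
  then show ?case
    using R[of "i + k"] by auto
qed simp

text \<open>A shortest cycle of asymmetric arcs has, by quasi-transitivity, all chords, and a chord in
  only one direction would close a shorter cycle.\<close>
lemma acyclic_asym_on:
  assumes qt: "quasi_transitive_on E U" and irr: "\<And>u. u \<in> U \<Longrightarrow> \<not> E u u"
    and free: "\<And>m f. 3 \<le> m \<Longrightarrow> f ` {..<m} \<subseteq> U \<Longrightarrow> \<not> anticycle E m f"
  shows "acyclic (asym_on E U)"
proof (rule ccontr)
  let ?R = "asym_on E U"
  let ?P = "\<lambda>m. 0 < m \<and> (\<exists>x. (x, x) \<in> ?R ^^ m)"
  assume "\<not> acyclic ?R"
  then obtain x where "(x, x) \<in> ?R\<^sup>+"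
    by (auto simp: acyclic_def)
  then have "\<exists>m. ?P m"
    using trancl_power by blast
  \<comment> \<open>\<open>m\<close> is the least length of a closed walk, over all starting
    vertices. A repeated vertex would cut off a shorter one, so the walk is a cycle
    (\<open>ne\<close>).\<close>
  then obtain m where m: "?P m" and "\<forall>k<m. \<not> ?P k"
    using exists_least_iff[of ?P] by blast
  then have short: "(x, x) \<notin> ?R ^^ k" if "0 < k" "k < m" for k x
    using that by blast
  obtain x g where g: "g 0 = x" "g m = x" "\<And>i. i < m \<Longrightarrow> (g i, g (Suc i)) \<in> ?R"
    using m relpow_fun_conv by metis
  \<comment> \<open>The periodic extension lets every chord be written as \<open>F i\<close>,
    \<open>F (i + k)\<close> without wrapping indices.\<close>
  define F where "F i = g (i mod m)" for i
  have F: "(F i, F (Suc i)) \<in> ?R" for i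
  proof -
    have "g (Suc i mod m) = g (Suc (i mod m))"
      using g by (simp add: mod_Suc)
    then show ?thesis
      using g(3)[of "i mod m"] m by (simp add: F_def)
  qed
  have per: "F (i + m) = F i" for i
    by (simp add: F_def)
  have pow: "(F i, F (i + k)) \<in> ?R ^^ k" for i k
    by (rule relpow_walk) (rule F)
  have FU: "F i \<in> U" and FE: "E (F i) (F (Suc i))" and FnE: "\<not> E (F (Suc i)) (F i)" for i
    using F[of i] by (auto simp: asym_on_def)
  have ne: "F i \<noteq> F (i + k)" if "0 < k" "k < m" for i k
    using pow[of i k] short[OF that, of "F i"] by metis
  have m3: "3 \<le> m"
  proof -
    have "m \<noteq> 1"
      using FE[of 0] irr[OF FU] per[of 0] by auto
    moreover have "m \<noteq> 2"
      using FE[of 0] FnE[of 1] per[of 0] by (auto simp: numeral_2_eq_2)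
    ultimately show ?thesis
      using m by linarith
  qed
  \<comment> \<open>A forward chord closes a walk of length \<open>m - k + 1\<close>, a backward one
    a walk of length \<open>k + 1\<close>; the bounds on \<open>k\<close> make both less than
    \<open>m\<close>.\<close>
  have both: "E (F i) (F (i + k)) \<and> E (F (i + k)) (F i)"
    if k: "2 \<le> k" "k + 2 \<le> m" and adj: "E (F i) (F (i + k)) \<or> E (F (i + k)) (F i)" for i k
  proof (rule ccontr)
    assume "\<not> ?thesis"
    then consider "(F i, F (i + k)) \<in> ?R" | "(F (i + k), F i) \<in> ?R"
      using adj FU by (auto simp: asym_on_def)
    then show False
    proof cases
      case 1
      have "(F (i + k), F i) \<in> ?R ^^ (m - k)"
        using pow[of "i + k" "m - k"] k per[of i] by simp
      with 1 have "(F i, F i) \<in> ?R ^^ Suc (m - k)"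
        by (rule relpow_Suc_I2)
      then show False
        using short[of "Suc (m - k)" "F i"] k by linarith
    next
      case 2
      then have "(F i, F i) \<in> ?R ^^ Suc k"
        using pow[of i k] by auto
      then show False
        using short[of "Suc k" "F i"] k by linarith
    qed
  qed
  have adjacent: "E (F i) (F (i + Suc k)) \<or> E (F (i + Suc k)) (F i)"
    if "E (F i) (F (i + k))" "1 \<le> k" "Suc k < m" for i k
  proof -
    have "F i \<noteq> F (i + k)" "F i \<noteq> F (i + Suc k)" "F (i + k) \<noteq> F (i + Suc k)"
      using ne[of k i] ne[of "Suc k" i] ne[of 1 "i + k"] that by auto
    then have "distinct [F i, F (i + k), F (i + Suc k)]"
      by simp
    moreover have "E (F (i + k)) (F (i + Suc k))"
      using FE[of "i + k"] by simp
    ultimately show ?thesis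
      using qt FU that(1) unfolding quasi_transitive_on_def by blast
  qed
  \<comment> \<open>Chords grow by one step at a time: the path \<open>F i\<close>,
    \<open>F (i + k)\<close>, \<open>F (i + Suc k)\<close> makes its ends adjacent, and
    \<open>both\<close> then supplies the forward arc that the next step starts from.\<close>
  have chord: "E (F i) (F (i + k)) \<and> E (F (i + k)) (F i)" if "2 \<le> k" "k + 2 \<le> m" for i k
    using that
  proof (induction k rule: dec_induct)
    case base
    have "E (F i) (F (i + Suc 1)) \<or> E (F (i + Suc 1)) (F i)"
      using base FE[of i] by (intro adjacent) auto
    then show ?case
      using both[of 2 i] base by (simp add: numeral_2_eq_2)
  next
    case (step k)
    then have "E (F i) (F (i + Suc k)) \<or> E (F (i + Suc k)) (F i)"
      by (intro adjacent) auto
    then show ?case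
      using both[of "Suc k" i] step by simp
  qed
  \<comment> \<open>The only pair too far apart for \<open>chord\<close> is that of the closing arc,
    from \<open>m - 1\<close> to \<open>0\<close>.\<close>
  have last: "i = 0 \<and> Suc j = m" if "i < j" "j < m" "\<not> j - i + 2 \<le> m" for i j
    using that by linarith
  have arcs: "(E (F i) (F j) \<longleftrightarrow> i \<noteq> Suc j mod m) \<and> (E (F j) (F i) \<longleftrightarrow> j \<noteq> Suc i mod m)"
    if ij: "i < j" "j < m" for i j
  proof -
    consider "j = Suc i" | "2 \<le> j - i" "j - i + 2 \<le> m" | "i = 0" "Suc j = m"
      using last[OF ij] ij by linarith
    then show ?thesis
    proof cases
      case 1
      then show ?thesis
        using FE[of i] FnE[of i] ij m3 by (auto simp: mod_Suc)
    next
      case 2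
      then show ?thesis
        using chord[of "j - i" i] ij by (auto simp: mod_Suc)
    next
      case 3
      then have "F (Suc j) = F 0"
        using per[of 0] by simp
      then show ?thesis
        using FE[of j] FnE[of j] ij 3 m3 by (auto simp: mod_Suc)
    qed
  qed
  have "anticycle E m F"
    unfolding anticycle_def
  proof (intro conjI allI impI)
    show "inj_on F {..<m}"
    proof (rule linorder_inj_onI)
      fix i j assume "i < j" "i \<in> {..<m}" "j \<in> {..<m}"
      then show "F i \<noteq> F j"
        using ne[of "j - i" i] by simp
    qed auto
    fix i j assume "i < m" "j < m"
    then show "E (F i) (F j) \<longleftrightarrow> i \<noteq> j \<and> i \<noteq> Suc j mod m"
      using arcs[of i j] arcs[of j i] irr[OF FU] by (cases i j rule: linorder_cases) auto
  qed
  then show False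
    using free[OF m3, of F] FU by blast
qed

text \<open>The converse of a finite acyclic relation is well-founded, and a minimal element for it
  has no asymmetric out-arc.\<close>

lemma asym_on_sink:
  assumes "finite U" "U \<noteq> {}" "acyclic (asym_on E U)"
  obtains v where "v \<in> U" "\<And>u. u \<in> U \<Longrightarrow> E v u \<Longrightarrow> E u v"
proof -
  have "finite (asym_on E U)"
    by (rule finite_subset[of _ "U \<times> U"]) (use assms(1) in \<open>auto simp: asym_on_def\<close>)
  then have "wf ((asym_on E U)\<inverse>)"
    using assms(3) by (rule finite_acyclic_wf_converse)
  moreover obtain x where "x \<in> U"
    using assms(2) by blast
  ultimately obtain v where "v \<in> U" "\<And>u. (u, v) \<in> (asym_on E U)\<inverse> \<Longrightarrow> u \<notin> U"
    by (rule wfE_min) blast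
  then show thesis
    using that unfolding asym_on_def by blast
qed

lemma acyclic_asym_on_subset: "acyclic (asym_on E V) \<Longrightarrow> U \<subseteq> V \<Longrightarrow> acyclic (asym_on E U)"
  unfolding asym_on_def by (erule acyclic_subset) blast

text \<open>If \<open>v\<close> has no asymmetric out-arc, it extends any kernel of the vertices without an arc to \<open>v\<close>.\<close>
lemma kernel_on_if_acyclic:
  assumes "finite U" "acyclic (asym_on E U)" "\<And>u. u \<in> U \<Longrightarrow> \<not> E u u"
  shows "\<exists>S. kernel_on E U S"
  using assms
proof (induction "card U" arbitrary: U rule: less_induct)
  case less
  show ?case
  proof (cases "U = {}")
    case True
    then show ?thesis by (auto simp: kernel_on_def)
  next
    case False
    then obtain v where v: "v \<in> U" "\<And>u. u \<in> U \<Longrightarrow> E v u \<Longrightarrow> E u v"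
      using asym_on_sink[OF less.prems(1) _ less.prems(2)] by blast
    define W where "W = {u \<in> U. u \<noteq> v \<and> \<not> E u v}"
    have W: "W \<subset> U" "W \<subseteq> U"
      using v by (auto simp: W_def)
    have "\<exists>S. kernel_on E W S"
    proof (rule less.hyps)
      show "card W < card U"
        using less.prems(1) W(1) by (rule psubset_card_mono)
      show "finite W"
        using W(2) less.prems(1) by (rule finite_subset)
      show "acyclic (asym_on E W)"
        using less.prems(2) W(2) by (rule acyclic_asym_on_subset)
    qed (use W less.prems in auto)
    then obtain S where S: "kernel_on E W S" ..
    \<comment> \<open>An arc from \<open>v\<close> into \<open>W\<close> would come with its
      reverse, against the choice of \<open>W\<close>; so \<open>insert v S\<close> is independent.
      All vertices outside \<open>W\<close> other than \<open>v\<close> are absorbed by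
      \<open>v\<close>.\<close>
    have "kernel_on E U (insert v S)"
      using S v less.prems unfolding kernel_on_def W_def by blast
    then show ?thesis ..
  qed
qed

section \<open>Weighted colourings of perfect graphs\<close>

text \<open>Chromatic number at most clique number, phrased through a common bound \<open>k\<close>
  so that neither number has to be computed.\<close>

definition perfect_on :: "('a \<Rightarrow> 'a \<Rightarrow> bool) \<Rightarrow> 'a set \<Rightarrow> bool" where
  "perfect_on A V \<longleftrightarrow> (\<forall>U\<subseteq>V. \<forall>k. (\<forall>K\<subseteq>U. pairwise A K \<longrightarrow> card K \<le> k) \<longrightarrow>
    (\<exists>c::'a \<Rightarrow> nat. c ` U \<subseteq> {..<k} \<and> (\<forall>u\<in>U. \<forall>v\<in>U. u \<noteq> v \<and> A u v \<longrightarrow> c u \<noteq> c v)))"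

lemma perfect_on_subset: "perfect_on A V \<Longrightarrow> U \<subseteq> V \<Longrightarrow> perfect_on A U"
  unfolding perfect_on_def by (meson order_trans)

abbreviation stable :: "('a \<Rightarrow> 'a \<Rightarrow> bool) \<Rightarrow> 'a set \<Rightarrow> bool" where
  "stable A \<equiv> pairwise (\<lambda>u v. \<not> A u v)"

text \<open>Amounts to a proper colouring with \<open>k\<close> colours after each \<open>v\<close>
  is replaced by a clique of \<open>w v\<close> copies.\<close>

definition weighted_colouring ::
    "('a \<Rightarrow> 'a \<Rightarrow> bool) \<Rightarrow> 'a set \<Rightarrow> ('a \<Rightarrow> nat) \<Rightarrow> nat \<Rightarrow> (nat \<Rightarrow> 'a set) \<Rightarrow> bool" where
  "weighted_colouring A V w k S \<longleftrightarrow> (\<forall>i<k. S i \<subseteq> V \<and> stable A (S i)) \<and>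
    (\<forall>v\<in>V. card {i. i < k \<and> v \<in> S i} = w v)"

text \<open>Double counting of the pairs of a vertex of \<open>K\<close> and a class containing
  it.\<close>

lemma weighted_colouring_sum:
  assumes "weighted_colouring A V w k S" "finite K" "K \<subseteq> V"
  shows "sum w K = (\<Sum>i<k. card (K \<inter> S i))"
proof -
  have "sum w K = (\<Sum>v\<in>K. card {i. i < k \<and> v \<in> S i})"
    using assms by (intro sum.cong) (auto simp: weighted_colouring_def)
  also have "\<dots> = (\<Sum>v\<in>K. \<Sum>i<k. of_bool (v \<in> S i))"
    by (intro sum.cong refl) (auto simp: sum_of_bool_eq intro!: arg_cong[where f = card])
  also have "\<dots> = (\<Sum>i<k. \<Sum>v\<in>K. of_bool (v \<in> S i))"
    by (rule sum.swap)
  also have "\<dots> = (\<Sum>i<k. card (K \<inter> S i))"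
    using assms by (intro sum.cong refl) (auto simp: sum_of_bool_eq Int_def intro!: arg_cong[where f = card])
  finally show ?thesis .
qed

lemma card_clique_stable_le_1:
  assumes "pairwise A K" "stable A S"
  shows "card (K \<inter> S) \<le> 1"
proof (cases "K \<inter> S = {}")
  case False
  then obtain x where x: "x \<in> K \<inter> S" by blast
  then have "K \<inter> S \<subseteq> {x}"
    using assms by (auto simp: pairwise_def)
  then show ?thesis
    using card_mono[of "{x}"] by simp
qed simp

text \<open>Lovasz' replication argument: after lowering the weight of \<open>x\<close> by one, some class \<open>T\<close> of the
  colouring contains \<open>x\<close>, and removing \<open>T\<close> from the original weights lowers the weight of every
  heaviest clique.\<close>
lemma perfect_weighted_colouring:
  assumes "finite V" "perfect_on A V"
    and "\<And>K. K \<subseteq> V \<Longrightarrow> pairwise A K \<Longrightarrow> sum w K \<le> k"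
  shows "\<exists>S. weighted_colouring A V w k S"
  using assms(3)
proof (induction "sum w V" arbitrary: w k rule: less_induct)
  case less
  note fin = finite_subset[OF _ assms(1)]
  show ?case
  proof (cases "\<forall>v\<in>V. w v \<le> 1")
    case True
    \<comment> \<open>With weights 0 and 1 the task is an ordinary colouring of the support
      \<open>U\<close>.\<close>
    define U where "U = {v \<in> V. w v = 1}"
    have "card K \<le> k" if "K \<subseteq> U" "pairwise A K" for K
    proof -
      have "card K = sum w K"
        using that by (subst card_eq_sum, intro sum.cong) (auto simp: U_def)
      then show ?thesis
        using less.prems[of K] that by (auto simp: U_def)
    qed
    moreover have "U \<subseteq> V"
      by (auto simp: U_def)
    ultimately obtain c where c: "c ` U \<subseteq> {..<k}"
        "\<And>u v. u \<in> U \<Longrightarrow> v \<in> U \<Longrightarrow> u \<noteq> v \<Longrightarrow> A u v \<Longrightarrow> c u \<noteq> c v"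
      using assms(2) unfolding perfect_on_def by metis
    have "card {i. i < k \<and> v \<in> {v \<in> U. c v = i}} = w v" if "v \<in> V" for v
    proof (cases "v \<in> U")
      case T: True
      then have "{i. i < k \<and> v \<in> {v \<in> U. c v = i}} = {c v}"
        using c by auto
      then show ?thesis
        using T by (simp add: U_def)
    next
      case False
      then have "w v = 0"
        using True that by (force simp: U_def)
      then show ?thesis
        using False by simp
    qed
    moreover have "stable A {v \<in> U. c v = i}" for i
      using c(2) unfolding pairwise_def by blast
    ultimately have "weighted_colouring A V w k (\<lambda>i. {v \<in> U. c v = i})"
      using \<open>U \<subseteq> V\<close> by (auto simp: weighted_colouring_def)
    then show ?thesis by blast
  next
    case False
    \<comment> \<open>Weight at least 2 keeps \<open>w'\<close> positive at \<open>x\<close>, so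
      that some class contains \<open>x\<close>.\<close>
    then obtain x where x: "x \<in> V" "2 \<le> w x"
      by force
    define w' where "w' = w(x := w x - 1)"
    have w': "sum w K = sum w' K + of_bool (x \<in> K)" if "K \<subseteq> V" for K
    proof -
      have "sum w K = sum (\<lambda>v. w' v + of_bool (v = x)) K"
        using x by (intro sum.cong) (auto simp: w'_def)
      then show ?thesis
        using fin[OF that] by (simp add: sum.distrib)
    qed
    have "\<exists>S. weighted_colouring A V w' k S"
    proof (rule less.hyps)
      show "sum w' V < sum w V"
        using w'[of V] x by simp
      show "sum w' K \<le> k" if "K \<subseteq> V" "pairwise A K" for K
        using less.prems[OF that] w'[OF that(1)] by linarith
    qed
    then obtain S where S: "weighted_colouring A V w' k S" ..
    have "card {i. i < k \<and> x \<in> S i} \<noteq> 0"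
      using S x by (auto simp: weighted_colouring_def w'_def)
    then obtain j where j: "j < k" "x \<in> S j"
      by (metis (mono_tags, lifting) Collect_empty_eq card.empty)
    define T where "T = S j"
    have T: "T \<subseteq> V" "stable A T" "x \<in> T"
      using S j by (auto simp: weighted_colouring_def T_def)
    \<comment> \<open>Positivity on \<open>T\<close> makes the truncated subtraction in
      \<open>w''\<close> exact.\<close>
    have pos: "1 \<le> w v" if "v \<in> T" for v
    proof -
      have "v \<in> V"
        using that T by auto
      moreover have "card {i. i < k \<and> v \<in> S i} \<noteq> 0"
        using j that by (subst card_0_eq) (auto simp: T_def)
      moreover have "card {i. i < k \<and> v \<in> S i} = w' v" if "v \<in> V"
        using S that by (simp add: weighted_colouring_def)
      ultimately have "w' v \<noteq> 0"
        by metis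
      then show ?thesis
        by (auto simp: w'_def split: if_splits)
    qed
    define w'' where "w'' v = w v - of_bool (v \<in> T)" for v
    have w'': "sum w K = sum w'' K + card (K \<inter> T)" if "K \<subseteq> V" for K
    proof -
      have "sum w K = sum (\<lambda>v. w'' v + of_bool (v \<in> T)) K"
        using pos by (intro sum.cong) (auto simp: w''_def)
      then show ?thesis
        using fin[OF that] by (simp add: sum.distrib sum_of_bool_eq Int_def)
    qed
    have "\<exists>S. weighted_colouring A V w'' (k - 1) S"
    proof (rule less.hyps)
      have "card (V \<inter> T) \<noteq> 0"
        using x T assms(1) by auto
      then show "sum w'' V < sum w V"
        using w''[of V] by simp
      show "sum w'' K \<le> k - 1" if K: "K \<subseteq> V" "pairwise A K" for K
      proof (cases "K \<inter> T = {}")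
        case False
        then have "card (K \<inter> T) \<noteq> 0"
          using fin[OF K(1)] by auto
        then show ?thesis
          using less.prems[OF K] w''[OF K(1)] by linarith
      next
        case True
        \<comment> \<open>A clique that misses \<open>T\<close> misses \<open>x\<close>, so all
          three weights agree on it; and it meets each of the \<open>k - 1\<close> classes other
          than \<open>T = S j\<close> at most once.\<close>
        have "sum w'' K = sum w' K"
          using w'[OF K(1)] w''[OF K(1)] True T by auto
        also have "\<dots> = (\<Sum>i<k. card (K \<inter> S i))"
          using weighted_colouring_sum[OF S fin] K by auto
        also have "\<dots> = (\<Sum>i\<in>{..<k} - {j}. card (K \<inter> S i))"
          using True j by (subst sum.remove[of _ j]) (auto simp: T_def)
        also have "\<dots> \<le> (\<Sum>i\<in>{..<k} - {j}. 1)"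
          using S K(2) by (intro sum_mono card_clique_stable_le_1) (auto simp: weighted_colouring_def)
        also have "\<dots> = k - 1"
          using j by simp
        finally show ?thesis .
      qed
    qed
    then obtain R where R: "weighted_colouring A V w'' (k - 1) R" ..
    have "card {i. i < k \<and> v \<in> (R(k - 1 := T)) i} = w v" if "v \<in> V" for v
    proof -
      let ?I = "{i. i < k - 1 \<and> v \<in> R i}"
      have "{i. i < k \<and> v \<in> (R(k - 1 := T)) i} = ?I \<union> {i. i = k - 1 \<and> v \<in> T}"
        using j by auto
      moreover have "card ?I = w'' v"
        using R that by (auto simp: weighted_colouring_def)
      ultimately show ?thesis
        using pos[of v] by (cases "v \<in> T") (auto simp: w''_def)
    qed
    then have "weighted_colouring A V w k (R(k - 1 := T))"
      using R T by (auto simp: weighted_colouring_def)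
    then show ?thesis by blast
  qed
qed

section \<open>Kernels in orientations of perfect graphs\<close>

text \<open>Kuhn's labelling lemma, the combinatorial core of Brouwer's fixed point theorem, carried
  from \<open>{..<n}\<close> to \<open>V\<close> along a bijection. The unit cube with lower corner
  \<open>q\<close> contains points with either label at each \<open>v\<close>.\<close>

lemma kuhn_lemma_finite:
  fixes label :: "('a \<Rightarrow> nat) \<Rightarrow> 'a \<Rightarrow> bool"
  assumes "finite V" "0 < p"
    and low: "\<And>x v. v \<in> V \<Longrightarrow> x v = 0 \<Longrightarrow> \<not> label x v"
    and high: "\<And>x v. v \<in> V \<Longrightarrow> x v = p \<Longrightarrow> label x v"
  obtains q where
    "\<And>v. v \<in> V \<Longrightarrow> \<exists>r. (\<forall>u\<in>V. q u \<le> r u \<and> r u \<le> q u + 1) \<and> label r v"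
    "\<And>v. v \<in> V \<Longrightarrow> \<exists>s. (\<forall>u\<in>V. q u \<le> s u \<and> s u \<le> q u + 1) \<and> \<not> label s v"
proof -
  define n where "n = card V"
  obtain h where h: "bij_betw h {..<n} V"
    using ex_bij_betw_nat_finite[OF assms(1)] by (auto simp: n_def atLeast0LessThan)
  define g where "g = inv_into {..<n} h"
  have gh: "g (h i) = i" if "i < n" for i
    using bij_betw_inv_into_left[OF h] that by (simp add: g_def)
  have hg: "g v < n" "h (g v) = v" if "v \<in> V" for v
    using bij_betw_inv_into_right[OF h that] bij_betwE[OF bij_betw_inv_into[OF h]] that
    by (auto simp: g_def)
  have hV: "h i \<in> V" if "i < n" for i
    using bij_betwE[OF h] that by auto
  define L where "L x i = (if label (x \<circ> g) (h i) then 1 else 0 :: nat)" for x i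
  obtain q where q: "\<forall>i<n. \<exists>r s. (\<forall>j<n. q j \<le> r j \<and> r j \<le> q j + 1) \<and>
      (\<forall>j<n. q j \<le> s j \<and> s j \<le> q j + 1) \<and> L r i \<noteq> L s i"
  proof (rule kuhn_lemma[of p n L])
    show "0 < p" by fact
  qed (auto simp: L_def hV gh low high)
  have main: "\<exists>r. (\<forall>u\<in>V. (q \<circ> g) u \<le> r u \<and> r u \<le> (q \<circ> g) u + 1) \<and> label r v = b"
    if v: "v \<in> V" for v b
  proof -
    obtain r s where rs: "\<forall>j<n. q j \<le> r j \<and> r j \<le> q j + 1" "\<forall>j<n. q j \<le> s j \<and> s j \<le> q j + 1"
        "L r (g v) \<noteq> L s (g v)"
      using q hg(1)[OF v] by blast
    then have "label (r \<circ> g) v = b \<or> label (s \<circ> g) v = b"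
      using hg[OF v] by (auto simp: L_def split: if_splits)
    moreover have "(q \<circ> g) u \<le> (r \<circ> g) u \<and> (r \<circ> g) u \<le> (q \<circ> g) u + 1"
      "(q \<circ> g) u \<le> (s \<circ> g) u \<and> (s \<circ> g) u \<le> (q \<circ> g) u + 1" if "u \<in> V" for u
      using rs(1,2) hg(1)[OF that] by auto
    ultimately show ?thesis
      by blast
  qed
  show thesis
    by (rule that[of "q \<circ> g"]) (use main[of _ True] main[of _ False] in auto)
qed

abbreviation adjacent :: "('a \<Rightarrow> 'a \<Rightarrow> bool) \<Rightarrow> 'a \<Rightarrow> 'a \<Rightarrow> bool" where
  "adjacent E u v \<equiv> E u v \<or> E v u"

text \<open>The order matters for the last vertex: a set meeting \<open>set (L @ [v])\<close>
  contains \<open>v\<close> or absorbs it.\<close>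

definition absorbing_list :: "('a \<Rightarrow> 'a \<Rightarrow> bool) \<Rightarrow> 'a set \<Rightarrow> 'a list \<Rightarrow> bool" where
  "absorbing_list E V L \<longleftrightarrow> set L \<subseteq> V \<and> sorted_wrt (\<lambda>u v. E v u) L"

lemma absorbing_list_snoc:
  "absorbing_list E V (L @ [v]) \<longleftrightarrow> absorbing_list E V L \<and> v \<in> V \<and> (\<forall>u\<in>set L. E v u)"
  by (auto simp: absorbing_list_def sorted_wrt_append)

lemma absorbing_list_clique: "absorbing_list E V L \<Longrightarrow> pairwise (adjacent E) (set L)"
  by (induction L rule: rev_induct) (auto simp: absorbing_list_snoc pairwise_def)

text \<open>A sink \<open>v\<close> of the asymmetric arcs receives an arc from every other vertex
  of the clique, so it can be put in front of a list of the rest.\<close>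

lemma clique_absorbing_list:
  assumes "finite K" "K \<subseteq> V" "pairwise (adjacent E) K" "acyclic (asym_on E K)"
  shows "\<exists>L. set L = K \<and> absorbing_list E V L"
  using assms
proof (induction "card K" arbitrary: K rule: less_induct)
  case less
  show ?case
  proof (cases "K = {}")
    case True
    then show ?thesis by (auto simp: absorbing_list_def)
  next
    case False
    then obtain v where v: "v \<in> K" "\<And>u. u \<in> K \<Longrightarrow> E v u \<Longrightarrow> E u v"
      using asym_on_sink[OF less.prems(1) _ less.prems(4)] by blast
    have "\<exists>L. set L = K - {v} \<and> absorbing_list E V L"
    proof (rule less.hyps)
      show "card (K - {v}) < card K"
        using less.prems(1) v(1) by (rule card_Diff1_less)
      show "pairwise (adjacent E) (K - {v})"
        using less.prems(3) by (auto simp: pairwise_def)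
      show "acyclic (asym_on E (K - {v}))"
        using less.prems(4) by (rule acyclic_asym_on_subset) auto
    qed (use less.prems in auto)
    then obtain L where L: "set L = K - {v}" "absorbing_list E V L" by blast
    moreover have "E u v" if "u \<in> K - {v}" for u
      using that v less.prems(3) by (auto simp: pairwise_def)
    ultimately have "set (v # L) = K" "absorbing_list E V (v # L)"
      using v(1) less.prems(2) by (auto simp: absorbing_list_def)
    then show ?thesis by blast
  qed
qed

text \<open>Kuhn's lemma provides the discrete counterpart of a fractional kernel (Aharoni and Holzman):
  weights below \<open>p\<close> on every clique such that each vertex ends an absorbing list that is almost full.\<close>
lemma discrete_fractional_kernel:
  assumes fin: "finite V" and p: "0 < p" and irr: "\<And>u. u \<in> V \<Longrightarrow> \<not> E u u"
  obtains q :: "'a \<Rightarrow> nat" where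
    "\<And>L. absorbing_list E V L \<Longrightarrow> sum q (set L) < p"
    "\<And>v. v \<in> V \<Longrightarrow> \<exists>L. absorbing_list E V (L @ [v]) \<and> p \<le> sum q (set (L @ [v])) + card V"
proof -
  \<comment> \<open>The clause \<open>x v \<noteq> 0\<close> gives the boundary condition at 0; at
    \<open>p\<close>, the one-element list \<open>[v]\<close> already has full weight.\<close>
  define label where "label x v \<longleftrightarrow> x v \<noteq> 0 \<and>
    (\<exists>L. absorbing_list E V (L @ [v]) \<and> p \<le> sum x (set (L @ [v])))" for x :: "'a \<Rightarrow> nat" and v
  have high: "label x v" if "v \<in> V" "x v = p" for x v
    unfolding label_def using that p by (intro conjI exI[of _ "[]"]) (auto simp: absorbing_list_def)
  have low: "\<not> label x v" if "x v = 0" for x v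
    using that by (simp add: label_def)
  obtain q where
    r: "\<And>v. v \<in> V \<Longrightarrow> \<exists>r. (\<forall>u\<in>V. q u \<le> r u \<and> r u \<le> q u + 1) \<and> label r v" and
    s: "\<And>v. v \<in> V \<Longrightarrow> \<exists>s. (\<forall>u\<in>V. q u \<le> s u \<and> s u \<le> q u + 1) \<and> \<not> label s v"
    by (rule kuhn_lemma_finite[of V p label, OF fin p]) (auto intro: high dest: low)
  \<comment> \<open>Induction on the list, comparing \<open>q\<close> with a point \<open>t\<close>
    of its cube not labelled at the last vertex \<open>v\<close>. Either \<open>t v = 0\<close>
    forces \<open>q v = 0\<close> and \<open>v\<close> adds no weight, or every absorbing list
    ending in \<open>v\<close> has \<open>t\<close>-weight below \<open>p\<close>, and
    \<open>q\<close> is at most \<open>t\<close> on \<open>V\<close>.\<close>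
  have "sum q (set L) < p" if "absorbing_list E V L" for L
    using that
  proof (induction L rule: rev_induct)
    case Nil
    then show ?case using p by simp
  next
    case (snoc v L)
    then have L: "absorbing_list E V L" "v \<in> V" "set (L @ [v]) \<subseteq> V"
      unfolding absorbing_list_snoc by (auto simp: absorbing_list_def)
    obtain t where t: "\<forall>u\<in>V. q u \<le> t u \<and> t u \<le> q u + 1" "\<not> label t v"
      using s[OF L(2)] by blast
    show ?case
    proof (cases "t v = 0")
      case True
      then have "q v = 0"
        using t L(2) by force
      then show ?thesis
        using snoc.IH[OF L(1)] by (cases "v \<in> set L") (auto simp: insert_absorb)
    next
      case False
      then have "sum t (set (L @ [v])) < p"
        using t(2) snoc.prems unfolding label_def by (meson not_le)
      moreover have "sum q (set (L @ [v])) \<le> sum t (set (L @ [v]))"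
        using t(1) L(3) by (intro sum_mono) auto
      ultimately show ?thesis by linarith
    qed
  qed
  \<comment> \<open>A labelled point exceeds \<open>q\<close> by at most 1 per vertex, so passing to
    \<open>q\<close> loses at most \<open>card V\<close>.\<close>
  moreover have "\<exists>L. absorbing_list E V (L @ [v]) \<and> p \<le> sum q (set (L @ [v])) + card V" if v: "v \<in> V" for v
  proof -
    obtain t where t: "\<forall>u\<in>V. q u \<le> t u \<and> t u \<le> q u + 1" "label t v"
      using r[OF v] by blast
    then obtain L where L: "absorbing_list E V (L @ [v])" "p \<le> sum t (set (L @ [v]))"
      by (auto simp: label_def)
    have LV: "set (L @ [v]) \<subseteq> V"
      using L(1) by (simp add: absorbing_list_def)
    have "sum t (set (L @ [v])) \<le> sum (\<lambda>u. q u + 1) (set (L @ [v]))"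
      using t(1) LV by (intro sum_mono) auto
    also have "\<dots> = sum q (set (L @ [v])) + card (set (L @ [v]))"
      by (subst sum.distrib) simp
    also have "card (set (L @ [v])) \<le> card V"
      using fin LV by (rule card_mono)
    finally have "sum t (set (L @ [v])) \<le> sum q (set (L @ [v])) + card V"
      by simp
    then show ?thesis
      using L by (meson order_trans)
  qed
  ultimately show thesis
    by (rule that)
qed

text \<open>Each of the \<open>n\<close> almost full absorbing lists is missed by at most \<open>n\<close> of the \<open>n\<^sup>2 + 1\<close> colour
  classes, so some class meets all of them.\<close>
theorem kernel_on_if_perfect:
  assumes fin: "finite V" and irr: "\<And>u. u \<in> V \<Longrightarrow> \<not> E u u"
    and perf: "perfect_on (adjacent E) V"
    and cliques: "\<And>K. K \<subseteq> V \<Longrightarrow> pairwise (adjacent E) K \<Longrightarrow> acyclic (asym_on E K)"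
  shows "\<exists>S. kernel_on E V S"
proof -
  define n where "n = card V"
  define p where "p = n * n + 1"
  obtain q where q: "\<And>L. absorbing_list E V L \<Longrightarrow> sum q (set L) < p"
    and "\<And>v. v \<in> V \<Longrightarrow> \<exists>L. absorbing_list E V (L @ [v]) \<and> p \<le> sum q (set (L @ [v])) + card V"
    using discrete_fractional_kernel[OF fin, of p E] irr by (auto simp: p_def)
  then obtain L where L: "\<And>v. v \<in> V \<Longrightarrow> absorbing_list E V (L v @ [v])"
    and full: "\<And>v. v \<in> V \<Longrightarrow> p \<le> sum q (set (L v @ [v])) + n"
    unfolding n_def by metis
  have "sum q K \<le> p" if "K \<subseteq> V" "pairwise (adjacent E) K" for K
    using clique_absorbing_list[OF finite_subset[OF that(1) fin] that cliques[OF that]] q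
    by (metis less_imp_le)
  then obtain S where S: "weighted_colouring (adjacent E) V q p S"
    using perfect_weighted_colouring[OF fin perf] by blast
  define C where "C v = set (L v @ [v])" for v
  define missed where "missed v = {i \<in> {..<p}. C v \<inter> S i = {}}" for v
  have missed: "card (missed v) \<le> n" if v: "v \<in> V" for v
  proof -
    have "sum q (C v) = (\<Sum>i<p. card (C v \<inter> S i))"
      using L[OF v] by (intro weighted_colouring_sum[OF S]) (auto simp: C_def absorbing_list_def)
    \<comment> \<open>\<open>C v\<close> is a clique and meets each stable class at most once, so
      its weight is bounded by the number of classes meeting it.\<close>
    also have "\<dots> \<le> (\<Sum>i<p. of_bool (i \<notin> missed v))"
    proof (rule sum_mono)
      fix i assume "i \<in> {..<p}"
      then show "card (C v \<inter> S i) \<le> of_bool (i \<notin> missed v)"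
        using card_clique_stable_le_1[OF absorbing_list_clique[OF L[OF v]], of "S i"] S
        by (auto simp: missed_def C_def weighted_colouring_def)
    qed
    also have "\<dots> = card ({..<p} - missed v)"
      by (simp add: sum_of_bool_eq Diff_eq Compl_eq)
    also have "\<dots> = p - card (missed v)"
      by (subst card_Diff_subset) (auto simp: missed_def)
    finally have "sum q (C v) \<le> p - card (missed v)" .
    moreover have "card (missed v) \<le> card {..<p}"
      by (rule card_mono) (auto simp: missed_def)
    ultimately show ?thesis
      using full[OF v] by (simp add: C_def)
  qed
  have "card (\<Union>v\<in>V. missed v) \<le> (\<Sum>v\<in>V. card (missed v))"
    by (rule card_UN_le[OF fin])
  also have "\<dots> \<le> n * n"
    using sum_bounded_above[of V "\<lambda>v. card (missed v)" n] missed by (simp add: n_def)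
  also have "\<dots> < card {..<p}"
    by (simp add: p_def)
  finally have "\<not> {..<p} \<subseteq> (\<Union>v\<in>V. missed v)"
    using card_mono[of "\<Union>v\<in>V. missed v" "{..<p}"] fin by (auto simp: missed_def)
  then obtain i where i: "i < p" "\<And>v. v \<in> V \<Longrightarrow> C v \<inter> S i \<noteq> {}"
    by (auto simp: missed_def)
  have "kernel_on E V (S i)"
    unfolding kernel_on_def
  proof (intro conjI ballI)
    show "S i \<subseteq> V"
      using S i by (auto simp: weighted_colouring_def)
    then show "\<not> E u v" if "u \<in> S i" "v \<in> S i" for u v
      using S i that irr by (cases "u = v") (auto simp: weighted_colouring_def pairwise_def)
    \<comment> \<open>\<open>S i\<close> meets \<open>L u @ [u]\<close> but not in \<open>u\<close>,
      hence in a vertex of \<open>L u\<close>, to which \<open>u\<close> has an arc.\<close>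
    show "\<exists>v\<in>S i. E u v" if "u \<in> V - S i" for u
      using L[of u] i(2)[of u] that by (auto simp: C_def absorbing_list_snoc)
  qed
  then show ?thesis ..
qed

text \<open>One representative from each part meeting \<open>U\<close> gives a clique
  \<open>K\<close>, so there are at most \<open>k\<close> such parts, and they serve as
  colours.\<close>

lemma perfect_on_multipartite:
  assumes "finite V" "\<And>u v. u \<in> V \<Longrightarrow> v \<in> V \<Longrightarrow> A u v \<longleftrightarrow> part u \<noteq> part v"
  shows "perfect_on A V"
  unfolding perfect_on_def
proof (intro allI impI)
  fix U k
  assume U: "U \<subseteq> V" and k: "\<forall>K\<subseteq>U. pairwise A K \<longrightarrow> card K \<le> k"
  obtain K where K: "K \<subseteq> U" "inj_on part K" "part ` U = part ` K"
    using subset_image_inj[of "part ` U" part U] by auto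
  have "pairwise A K"
    using K U assms(2) by (auto simp: pairwise_def inj_on_def subset_iff)
  then have "card (part ` U) \<le> k"
    using K k card_image by metis
  moreover have "finite (part ` U)"
    using assms(1) U finite_subset by auto
  ultimately obtain h where h: "inj_on h (part ` U)" "h ` part ` U \<subseteq> {..<k}"
    using card_le_inj[of "part ` U" "{..<k}"] by auto
  show "\<exists>c::'a \<Rightarrow> nat. c ` U \<subseteq> {..<k} \<and> (\<forall>u\<in>U. \<forall>v\<in>U. u \<noteq> v \<and> A u v \<longrightarrow> c u \<noteq> c v)"
    by (rule exI[of _ "h \<circ> part"]) (use h U assms(2) in \<open>auto simp: inj_on_def subset_iff\<close>)
qed

section \<open>Induced subdigraphs and forbidden digraphs\<close>

definition no_anticycle :: "('a \<Rightarrow> 'a \<Rightarrow> bool) \<Rightarrow> 'a set \<Rightarrow> bool" where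
  "no_anticycle E V \<longleftrightarrow> (\<forall>m\<ge>3. \<forall>f. f ` {..<m} \<subseteq> V \<longrightarrow> \<not> anticycle E m f)"

text \<open>An anticycle is itself a subset without kernel. Conversely, a clique is
  quasi-transitive, as any two of its vertices are adjacent; so without anticycles the asymmetric
  arcs are acyclic on cliques, and on all of \<open>U\<close> in the quasi-transitive case.\<close>

lemma kernels_iff_no_anticycle:
  assumes fin: "finite V" and irr: "\<And>u. u \<in> V \<Longrightarrow> \<not> E u u"
    and "perfect_on (adjacent E) V \<or> quasi_transitive_on E V"
  shows "(\<forall>U\<subseteq>V. \<exists>S. kernel_on E U S) \<longleftrightarrow> no_anticycle E V"
proof
  assume "\<forall>U\<subseteq>V. \<exists>S. kernel_on E U S"
  then show "no_anticycle E V"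
    unfolding no_anticycle_def using anticycle_no_kernel by metis
next
  assume free: "no_anticycle E V"
  have acyclic: "acyclic (asym_on E K)" if "K \<subseteq> V" "quasi_transitive_on E K" for K
    using that(2)
  proof (rule acyclic_asym_on)
    show "\<not> anticycle E m f" if "3 \<le> m" "f ` {..<m} \<subseteq> K" for m f
      using free that \<open>K \<subseteq> V\<close> by (auto simp: no_anticycle_def)
  qed (use irr that in auto)
  show "\<forall>U\<subseteq>V. \<exists>S. kernel_on E U S"
    using assms(3)
  proof (elim disjE; intro allI impI)
    fix U assume U: "U \<subseteq> V" and "perfect_on (adjacent E) V"
    then have "perfect_on (adjacent E) U"
      by (rule perfect_on_subset[rotated])
    moreover have "acyclic (asym_on E K)" if "K \<subseteq> U" "pairwise (adjacent E) K" for K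
      using U that by (intro acyclic) (auto simp: quasi_transitive_on_def pairwise_def)
    ultimately show "\<exists>S. kernel_on E U S"
      using irr U finite_subset[OF U fin] by (intro kernel_on_if_perfect) auto
  next
    fix U assume U: "U \<subseteq> V" and "quasi_transitive_on E V"
    then have "quasi_transitive_on E U"
      by (auto simp: quasi_transitive_on_def subset_iff)
    then show "\<exists>S. kernel_on E U S"
      using acyclic[OF U] irr U finite_subset[OF U fin] by (intro kernel_on_if_acyclic) auto
  qed
qed

section \<open>Translation of the digraph notions to relations on vertex sets\<close>

lemma dominates_induced_subgraph:
  assumes "induced_subgraph H D"
  shows "u \<rightarrow>\<^bsub>H\<^esub> v \<longleftrightarrow> u \<in> verts H \<and> v \<in> verts H \<and> u \<rightarrow>\<^bsub>D\<^esub> v"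
  using assms by (auto simp: induced_subgraph_def subgraph_def compatible_def arcs_ends_conv)

lemma (in wf_digraph) ex_induced_subgraph_iff:
  "(\<exists>H. induced_subgraph H G \<and> verts H = U) \<longleftrightarrow> U \<subseteq> verts G"
proof
  assume "U \<subseteq> verts G"
  then show "\<exists>H. induced_subgraph H G \<and> verts H = U"
    by (intro exI[of _ "G \<restriction> U"]) (simp add: induced_induce)
qed (auto simp: induced_subgraph_def subgraph_def)

lemma (in wf_digraph) kernel_perfect_iff:
  "kernel_perfect G \<longleftrightarrow> (\<forall>U\<subseteq>verts G. \<exists>S. kernel_on (dominates G) U S)"
proof -
  have "is_kernel H S \<longleftrightarrow> kernel_on (dominates G) (verts H) S" if "induced_subgraph H G" for H S
    unfolding is_kernel_def kernel_on_def dominates_induced_subgraph[OF that] by blast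
  moreover have "kernel_perfect G \<longleftrightarrow> (\<forall>H. induced_subgraph H G \<longrightarrow> (\<exists>S. is_kernel H S))"
    using induced_subgraph_refl by (auto simp: kernel_perfect_def)
  ultimately show ?thesis
    using ex_induced_subgraph_iff by metis
qed

lemma dominates_underlying_graph: "u \<rightarrow>\<^bsub>underlying_graph D\<^esub> v \<longleftrightarrow> adjacent (dominates D) u v"
  by (auto simp: parcs_mk_symmetric arcs_ends_conv)

lemma perfect_on_if_perfect_graph:
  assumes "perfect_graph G"
  shows "perfect_on (dominates G) (verts G)"
  unfolding perfect_on_def
proof (intro allI impI)
  interpret graph G
    using assms unfolding perfect_graph_def by blast
  fix U k
  assume U: "U \<subseteq> verts G" and k: "\<forall>K\<subseteq>U. pairwise (dominates G) K \<longrightarrow> card K \<le> k"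
  obtain H where H: "induced_subgraph H G" "verts H = U"
    using ex_induced_subgraph_iff[THEN iffD2, OF U] by (elim exE conjE)
  have fin: "finite U"
    using U finite_verts finite_subset by blast
  have clique: "is_clique H K \<longleftrightarrow> K \<subseteq> U \<and> pairwise (dominates G) K" for K
    unfolding is_clique_def pairwise_def dominates_induced_subgraph[OF H(1)] H(2) by blast
  have "clique_number H \<le> k"
    unfolding clique_number_def
  proof (rule Max.boundedI)
    have "{K. is_clique H K} \<subseteq> Pow U"
      by (auto simp: clique)
    then show "finite (card ` {K. is_clique H K})"
      using fin by (meson finite_Pow_iff finite_imageI finite_subset)
    show "card ` {K. is_clique H K} \<noteq> {}"
      using clique[of "{}"] by auto
  qed (use k clique in auto)
  \<comment> \<open>\<open>LEAST\<close> is attained once some colouring exists; an injective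
    numbering of the vertices is one.\<close>
  obtain h where h: "h ` U = {..<card U}" "inj_on h U"
    using ex_bij_betw_finite_nat[OF fin] by (auto simp: bij_betw_def atLeast0LessThan)
  have "h u \<noteq> h v" if "u \<rightarrow>\<^bsub>H\<^esub> v" for u v
    using h(2) that adj_not_same unfolding dominates_induced_subgraph[OF H(1)] H(2) inj_on_def by metis
  then have "colourable H (card U)"
    unfolding colourable_def using h H(2) by (intro exI[of _ h]) auto
  then have "colourable H (chromatic_number H)"
    unfolding chromatic_number_def by (rule LeastI)
  then obtain c where "c ` verts H \<subseteq> {..<chromatic_number H}" "\<forall>u v. u \<rightarrow>\<^bsub>H\<^esub> v \<longrightarrow> c u \<noteq> c v"
    by (auto simp: colourable_def)
  moreover have "chromatic_number H \<le> k"
    using assms H(1) \<open>clique_number H \<le> k\<close> by (simp add: perfect_graph_def)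
  ultimately show "\<exists>c::'a \<Rightarrow> nat. c ` U \<subseteq> {..<k} \<and> (\<forall>u\<in>U. \<forall>v\<in>U. u \<noteq> v \<and> u \<rightarrow>\<^bsub>G\<^esub> v \<longrightarrow> c u \<noteq> c v)"
    unfolding dominates_induced_subgraph[OF H(1)] H(2)
    by (intro exI[of _ c]) force
qed

lemma perfect_on_if_complete_multipartite:
  assumes "complete_multipartite G"
  shows "perfect_on (dominates G) (verts G)"
proof -
  interpret graph G
    using assms unfolding complete_multipartite_def by blast
  obtain P where P: "partition_on (verts G) P"
    and arcs: "arcs_ends G = {(u,v). \<exists>X\<in>P. \<exists>Y\<in>P. X \<noteq> Y \<and> u \<in> X \<and> v \<in> Y}"
    using assms by (auto simp: complete_multipartite_def)
  define part where "part v = (THE X. X \<in> P \<and> v \<in> X)" for v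
  have part: "part v = X" if "X \<in> P" "v \<in> X" for v X
    unfolding part_def using that P by (intro the_equality) (auto simp: partition_on_def disjoint_def)
  have ex: "\<exists>X\<in>P. v \<in> X" if "v \<in> verts G" for v
    using that P by (auto simp: partition_on_def)
  show ?thesis
  proof (rule perfect_on_multipartite)
    fix u v assume "u \<in> verts G" "v \<in> verts G"
    then obtain X Y where "X \<in> P" "u \<in> X" "Y \<in> P" "v \<in> Y"
      using ex by meson
    then have "part u = X" "part v = Y" "u \<rightarrow>\<^bsub>G\<^esub> v \<longleftrightarrow> (\<exists>X'\<in>P. \<exists>Y'\<in>P. X' \<noteq> Y' \<and> u \<in> X' \<and> v \<in> Y')"
      using part by (simp_all add: arcs)
    then show "u \<rightarrow>\<^bsub>G\<^esub> v \<longleftrightarrow> part u \<noteq> part v"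
      using part \<open>X \<in> P\<close> \<open>u \<in> X\<close> \<open>Y \<in> P\<close> \<open>v \<in> Y\<close> by metis
  qed simp
qed

text \<open>Serves the triangle and the circulants alike: \<open>C\<close> is any digraph on
  \<open>0, ..., m - 1\<close> with the arcs of an anticycle. Forwards, \<open>f\<close> inverts the
  isomorphism on vertices; backwards, the image of \<open>f\<close> induces the copy.\<close>

lemma induced_subgraph_iso_iff_anticycle:
  fixes D :: "('a, 'b) pre_digraph" and C :: "int pair_pre_digraph"
  assumes "digraph D" and V: "pverts C = int ` {..<m}"
    and A: "parcs C = {(int i, int j) | i j. i < m \<and> j < m \<and> i \<noteq> j \<and> i \<noteq> Suc j mod m}"
  shows "(\<exists>H. induced_subgraph H D \<and> digraph_iso H (with_proj C)) \<longleftrightarrow>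
    (\<exists>f. f ` {..<m} \<subseteq> verts D \<and> anticycle (dominates D) m f)"
proof
  assume "\<exists>H. induced_subgraph H D \<and> digraph_iso H (with_proj C)"
  then obtain H hom where H: "induced_subgraph H D" "pre_digraph.digraph_isomorphism H hom"
    and C: "with_proj C = app_iso hom H"
    by (auto simp: digraph_iso_def)
  define g where "g = iso_verts hom"
  have g: "inj_on g (verts H)" "g ` verts H = int ` {..<m}"
    using H(2) arg_cong[OF C, of verts] V
    by (auto simp: g_def pre_digraph.digraph_isomorphism_def)
  have "arcs_ends (app_iso hom H) = map_prod g g ` arcs_ends H"
    using H(2) by (auto simp: arcs_ends_conv g_def pre_digraph.digraph_isomorphism_def image_image)
  then have parcs: "parcs C = map_prod g g ` arcs_ends H"
    using arg_cong[OF C, of arcs_ends] by simp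
  define f where "f i = inv_into (verts H) g (int i)" for i
  have f: "f i \<in> verts H" "g (f i) = int i" if "i < m" for i
    using that g(2) inv_into_into[of "int i" g "verts H"] f_inv_into_f[of "int i" g "verts H"]
    by (auto simp: f_def)
  have "f i \<rightarrow>\<^bsub>D\<^esub> f j \<longleftrightarrow> i \<noteq> j \<and> i \<noteq> Suc j mod m" if ij: "i < m" "j < m" for i j
  proof -
    have "f i \<rightarrow>\<^bsub>D\<^esub> f j \<longleftrightarrow> f i \<rightarrow>\<^bsub>H\<^esub> f j"
      using f ij by (simp add: dominates_induced_subgraph[OF H(1)])
    also have "\<dots> \<longleftrightarrow> (int i, int j) \<in> parcs C"
    proof
      assume "(int i, int j) \<in> parcs C"
      then obtain u v where uv: "u \<rightarrow>\<^bsub>H\<^esub> v" "g u = int i" "g v = int j"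
        by (auto simp: parcs)
      then have "u \<in> verts H" "v \<in> verts H" "g u = g (f i)" "g v = g (f j)"
        using f ij by (simp_all add: dominates_induced_subgraph[OF H(1)])
      then have "u = f i" "v = f j"
        using inj_onD[OF g(1)] f(1) ij by blast+
      with uv(1) show "f i \<rightarrow>\<^bsub>H\<^esub> f j" by simp
    next
      assume "f i \<rightarrow>\<^bsub>H\<^esub> f j"
      then have "map_prod g g (f i, f j) \<in> map_prod g g ` arcs_ends H"
        by (rule imageI)
      then show "(int i, int j) \<in> parcs C"
        using f ij by (simp add: parcs)
    qed
    finally show ?thesis
      using ij by (simp add: A)
  qed
  moreover have "inj_on f {..<m}"
    using f(2) by (metis inj_onI lessThan_iff of_nat_eq_iff)
  moreover have "f ` {..<m} \<subseteq> verts D"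
    using f(1) H(1) by (auto simp: induced_subgraph_def subgraph_def)
  ultimately show "\<exists>f. f ` {..<m} \<subseteq> verts D \<and> anticycle (dominates D) m f"
    by (auto simp: anticycle_def)
next
  interpret digraph D by fact
  assume "\<exists>f. f ` {..<m} \<subseteq> verts D \<and> anticycle (dominates D) m f"
  then obtain f where f: "f ` {..<m} \<subseteq> verts D" "inj_on f {..<m}"
    and dom: "\<And>i j. i < m \<Longrightarrow> j < m \<Longrightarrow> f i \<rightarrow>\<^bsub>D\<^esub> f j \<longleftrightarrow> i \<noteq> j \<and> i \<noteq> Suc j mod m"
    by (auto simp: anticycle_def)
  define H where "H = D \<restriction> (f ` {..<m})"
  define g where "g v = int (inv_into {..<m} f v)" for v
  have gf: "g (f i) = int i" if "i < m" for i
    using f(2) that by (simp add: g_def)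
  have H: "induced_subgraph H D" "verts H = f ` {..<m}"
    using f(1) induced_induce by (auto simp: H_def)
  have ends: "tail H = tail D" "head H = head D"
    by (simp_all add: H_def)
  define hom :: "('a, 'b, int, int \<times> int) digraph_isomorphism" where
    "hom = \<lparr>iso_verts = g, iso_arcs = (\<lambda>e. (g (tail D e), g (head D e))),
      iso_head = snd, iso_tail = fst\<rparr>"
  have g_inj: "inj_on g (verts H)"
    using gf H(2) by (auto intro!: inj_onI)
  \<comment> \<open>The ends determine an arc because \<open>D\<close> has no parallel arcs.\<close>
  have "inj_on (\<lambda>e. (g (tail D e), g (head D e))) (arcs H)"
  proof (rule inj_onI)
    fix e e' assume e: "e \<in> arcs H" "e' \<in> arcs H"
      and eq: "(g (tail D e), g (head D e)) = (g (tail D e'), g (head D e'))"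
    have "tail D e = tail D e'" "head D e = head D e'"
      using g_inj e eq H(2) by (auto simp: H_def dest: inj_onD)
    then show "e = e'"
      using no_multi_arcs e by (auto simp: H_def arc_to_ends_def)
  qed
  moreover have "wf_digraph H"
    using H(1) by (simp add: induced_subgraph_def subgraph_def)
  ultimately have "pre_digraph.digraph_isomorphism H hom"
    using g_inj by (simp add: pre_digraph.digraph_isomorphism_def hom_def ends)
  moreover have "with_proj C = app_iso hom H"
  proof -
    have "parcs C = map_prod g g ` arcs_ends H"
    proof (intro set_eqI iffI)
      fix e assume "e \<in> parcs C"
      then obtain i j where ij: "e = (int i, int j)" "i < m" "j < m" "f i \<rightarrow>\<^bsub>D\<^esub> f j"
        using dom by (auto simp: A)
      then have "f i \<rightarrow>\<^bsub>H\<^esub> f j"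
        using H(2) by (simp add: dominates_induced_subgraph[OF H(1)])
      then have "map_prod g g (f i, f j) \<in> map_prod g g ` arcs_ends H"
        by (rule imageI)
      then show "e \<in> map_prod g g ` arcs_ends H"
        using ij gf by simp
    next
      fix e assume "e \<in> map_prod g g ` arcs_ends H"
      then obtain i j where "e = (g (f i), g (f j))" "i < m" "j < m" "f i \<rightarrow>\<^bsub>D\<^esub> f j"
        using H by (auto simp: dominates_induced_subgraph[OF H(1)])
      then show "e \<in> parcs C"
        using gf dom by (auto simp: A)
    qed
    also have "\<dots> = (\<lambda>e. (g (tail D e), g (head D e))) ` arcs H"
      by (simp add: arcs_ends_conv image_image ends)
    finally have "parcs C = (\<lambda>e. (g (tail D e), g (head D e))) ` arcs H" .
    moreover have "pverts C = g ` verts H"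
      using gf by (simp add: V H(2) image_image)
    ultimately show ?thesis
      by (simp add: with_proj_def app_iso_def hom_def)
  qed
  ultimately show "\<exists>H. induced_subgraph H D \<and> digraph_iso H (with_proj C)"
    using H(1) by (auto simp: digraph_iso_def)
qed

section \<open>The forbidden digraphs in terms of differences modulo \<open>m\<close>\<close>

lemma parcs_directed_triangle:
  "parcs directed_triangle = {(int i, int j) | i j. i < 3 \<and> j < 3 \<and> i \<noteq> j \<and> i \<noteq> Suc j mod 3}"
proof (intro equalityI subsetI)
  fix e assume "e \<in> parcs directed_triangle"
  then consider "e = (int 0, int 1)" | "e = (int 1, int 2)" | "e = (int 2, int 0)"
    by (auto simp: directed_triangle_def)
  then show "e \<in> {(int i, int j) | i j. i < 3 \<and> j < 3 \<and> i \<noteq> j \<and> i \<noteq> Suc j mod 3}"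
    by cases (intro CollectI exI conjI, assumption, simp_all)+
next
  fix e assume "e \<in> {(int i, int j) | i j. i < 3 \<and> j < 3 \<and> i \<noteq> j \<and> i \<noteq> Suc j mod 3}"
  then obtain i j where e: "e = (int i, int j)" and ij: "i < 3" "j < 3" "i \<noteq> j" "i \<noteq> Suc j mod 3"
    by blast
  then have "i = 0 \<or> i = 1 \<or> i = 2" "j = 0 \<or> j = 1 \<or> j = 2"
    by linarith+
  then show "e \<in> parcs directed_triangle"
    using ij(3,4) unfolding e by (elim disjE) (simp_all add: directed_triangle_def)
qed

text \<open>The jumps represent every residue modulo \<open>m\<close> except 0 and -1, and
  \<open>j - i\<close> congruent to -1 means that \<open>i\<close> is the cyclic successor of
  \<open>j\<close>.\<close>

lemma cong_jumps_iff:
  assumes "4 \<le> m" "i < m" "j < m"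
  shows "(\<exists>k\<in>jumps m. [int j - int i = k] (mod int m)) \<longleftrightarrow> i \<noteq> j \<and> i \<noteq> Suc j mod m"
proof
  assume "\<exists>k\<in>jumps m. [int j - int i = k] (mod int m)"
  then obtain k where k: "k \<in> jumps m" and "[int j - int i = k] (mod int m)"
    by blast
  then have "int m dvd int j - int i - k"
    by (simp add: cong_iff_dvd_diff)
  then obtain l where l: "int j - int i - k = int m * l" ..
  \<comment> \<open>\<open>4 \<le> m\<close> gives \<open>m div 2 \<le> m - 2\<close>; hence
    \<open>k\<close> and \<open>k + 1\<close> are nonzero and below \<open>m\<close> in absolute
    value, so neither is a multiple of \<open>m\<close>.\<close>
  have range: "- int m + 2 \<le> k" "k \<le> int m - 2" "k \<noteq> 0" "k \<noteq> - 1"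
    using k assms(1) by (auto simp: jumps_def)
  have small: "l = 0" if "\<bar>int m * l\<bar> < int m" for l
    using that assms(1) by (simp add: abs_mult)
  have "i \<noteq> j"
  proof
    assume "i = j"
    then have "int m * l = - k"
      using l by simp
    then show False
      using small[of l] range by force
  qed
  moreover have "i \<noteq> Suc j" if "Suc j < m"
  proof
    assume "i = Suc j"
    then have "int m * l = - k - 1"
      using l by simp
    then show False
      using small[of l] range by force
  qed
  moreover have "i \<noteq> 0" if "Suc j = m"
  proof
    assume "i = 0"
    then have "int m * (l - 1) = - k - 1"
      using l that by (simp add: algebra_simps)
    then show False
      using small[of "l - 1"] range by force
  qed
  ultimately show "i \<noteq> j \<and> i \<noteq> Suc j mod m"
    using assms(3) by (auto simp: mod_Suc)
next
  assume ne: "i \<noteq> j \<and> i \<noteq> Suc j mod m"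
  \<comment> \<open>\<open>d\<close> is the least nonnegative residue of \<open>j - i\<close>; the
    values 0 and \<open>m - 1\<close> are excluded. The lower half gives the jump \<open>d\<close>,
    the upper half the negative jump \<open>d - m\<close>.\<close>
  define d where "d = (if i \<le> j then int j - int i else int j - int i + int m)"
  have d: "1 \<le> d" "d \<le> int m - 2"
    using ne assms by (auto simp: d_def mod_Suc split: if_splits)
  have cong: "[int j - int i = d] (mod int m)" "[int j - int i = d - int m] (mod int m)"
    by (auto simp: d_def cong_iff_dvd_diff)
  show "\<exists>k\<in>jumps m. [int j - int i = k] (mod int m)"
  proof (cases "d \<le> int (m div 2)")
    case True
    then have "d \<in> jumps m"
      using d by (cases "d = 1") (auto simp: jumps_def)
    then show ?thesis
      using cong by blast
  next
    case False
    then have "int m - d \<in> {2..int (m div 2)}"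
      using d by auto
    then have "d - int m \<in> jumps m"
      unfolding jumps_def by force
    then show ?thesis
      using cong by blast
  qed
qed

lemma parcs_circulant_jumps:
  assumes "4 \<le> m"
  shows "parcs (circulant m (jumps m)) =
    {(int i, int j) | i j. i < m \<and> j < m \<and> i \<noteq> j \<and> i \<noteq> Suc j mod m}"
proof -
  have "{0..<int m} = int ` {..<m}"
    by (simp add: image_int_atLeastLessThan lessThan_atLeast0)
  then have "parcs (circulant m (jumps m)) =
      {(int i, int j) | i j. i < m \<and> j < m \<and> (\<exists>k\<in>jumps m. [int j - int i = k] (mod int m))}"
    unfolding circulant_def by auto
  also have "\<dots> = {(int i, int j) | i j. i < m \<and> j < m \<and> i \<noteq> j \<and> i \<noteq> Suc j mod m}"
    by (simp add: cong_jumps_iff[OF assms] cong: conj_cong)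
  finally show ?thesis .
qed

text \<open>The triangle is the pattern for \<open>m = 3\<close> and the circulants are those for
  \<open>m \<ge> 4\<close>, so together they exhaust \<open>m \<ge> 3\<close>.\<close>

lemma forbidden_iff_anticycle:
  fixes D :: "('a, 'b) pre_digraph"
  assumes "digraph D"
  shows "(\<exists>H. induced_subgraph H D \<and>
      (digraph_iso H (with_proj directed_triangle) \<or>
       (\<exists>n\<ge>4. digraph_iso H (with_proj (circulant n (jumps n)))))) \<longleftrightarrow>
    \<not> no_anticycle (dominates D) (verts D)"
proof -
  have "pverts directed_triangle = int ` {..<3}"
    by (auto simp: directed_triangle_def lessThan_nat_numeral lessThan_Suc)
  note triangle = induced_subgraph_iso_iff_anticycle[OF assms this parcs_directed_triangle]
  have "pverts (circulant n (jumps n)) = int ` {..<n}" for n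
    by (simp add: circulant_def image_int_atLeastLessThan lessThan_atLeast0)
  note circulant = induced_subgraph_iso_iff_anticycle[OF assms this parcs_circulant_jumps]
  have "(\<exists>H. induced_subgraph H D \<and>
      (digraph_iso H (with_proj directed_triangle) \<or>
       (\<exists>n\<ge>4. digraph_iso H (with_proj (circulant n (jumps n)))))) \<longleftrightarrow>
    (\<exists>H. induced_subgraph H D \<and> digraph_iso H (with_proj directed_triangle)) \<or>
    (\<exists>n\<ge>4. \<exists>H. induced_subgraph H D \<and> digraph_iso H (with_proj (circulant n (jumps n))))"
    by blast
  also have "\<dots> \<longleftrightarrow> (\<exists>f. f ` {..<3} \<subseteq> verts D \<and> anticycle (dominates D) 3 f) \<or>
      (\<exists>n\<ge>4. \<exists>f. f ` {..<n} \<subseteq> verts D \<and> anticycle (dominates D) n f)"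
    using triangle circulant by (intro arg_cong2[where f = "(\<or>)"] ex_cong1 conj_cong refl) assumption+
  also have "\<dots> \<longleftrightarrow> (\<exists>m. (m = 3 \<or> 4 \<le> m) \<and> (\<exists>f. f ` {..<m} \<subseteq> verts D \<and> anticycle (dominates D) m f))"
    by (simp only: ex_disj_distrib conj_disj_distribR simp_thms ex_simps)
  also have "\<dots> \<longleftrightarrow> (\<exists>m\<ge>3. \<exists>f. f ` {..<m} \<subseteq> verts D \<and> anticycle (dominates D) m f)"
    by (intro ex_cong1 conj_cong refl) linarith
  finally show ?thesis
    by (simp add: no_anticycle_def)
qed

theorem theorem6:
  fixes D :: "('a,'b) pre_digraph"
  assumes "digraph D"
  shows "(perfect_graph (underlying_graph D) \<longrightarrow>
           (kernel_perfect D \<longleftrightarrow>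
             \<not> (\<exists>H. induced_subgraph H D \<and>
                 (digraph_iso H (with_proj directed_triangle) \<or>
                  (\<exists>n\<ge>4. digraph_iso H (with_proj (circulant n (jumps n))))))))
       \<and> (semicomplete_multipartite D \<or> quasi_transitive D \<longrightarrow>
           (kernel_perfect D \<longleftrightarrow>
             \<not> (\<exists>H. induced_subgraph H D \<and>
                 (digraph_iso H (with_proj directed_triangle) \<or>
                  (\<exists>m\<ge>4. digraph_iso H (with_proj (circulant m (jumps m))))))))"
proof -
  interpret digraph D by fact
  have underlying: "dominates (underlying_graph D) = adjacent (dominates D)"
    "verts (underlying_graph D) = verts D"
    unfolding dominates_underlying_graph by auto
  have irr: "\<not> u \<rightarrow>\<^bsub>D\<^esub> u" for u
    using adj_not_same by blast
  have "kernel_perfect D \<longleftrightarrow> no_anticycle (dominates D) (verts D)"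
    if "perfect_on (adjacent (dominates D)) (verts D) \<or> quasi_transitive_on (dominates D) (verts D)"
    unfolding kernel_perfect_iff
    using finite_verts irr that by (rule kernels_iff_no_anticycle)
  moreover have "perfect_graph (underlying_graph D) \<Longrightarrow> perfect_on (adjacent (dominates D)) (verts D)"
    using perfect_on_if_perfect_graph[of "underlying_graph D"] unfolding underlying .
  moreover have "semicomplete_multipartite D \<Longrightarrow> perfect_on (adjacent (dominates D)) (verts D)"
    using perfect_on_if_complete_multipartite[of "underlying_graph D"]
    unfolding underlying semicomplete_multipartite_def .
  moreover have "quasi_transitive D \<Longrightarrow> quasi_transitive_on (dominates D) (verts D)"
    by (auto simp: quasi_transitive_def quasi_transitive_on_def)
  ultimately show ?thesis
    unfolding forbidden_iff_anticycle[OF assms] by blast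
qed

end
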